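(* Let $G$ be a maximally almost periodic (MAP) topological group. Then $C_0(G)\subseteq\mathcal{H}(G)$. If $G$ is not compact then even $\mathcal{F}_0(G)\subseteq\mathcal{H}_0(G)$.
   Context: Compact spaces are Hausdorff. A group compactification of $G$ is a pair $(\iota,C)$ where $C$ is a compact topological group and $\iota:G\to C$ is a continuous group homomorphism with dense image; $\mu_C$ is the (completed) normalized Haar measure on $C$. The maximal group compactification is the Bohr compactification $(\iota_b,bG)$. $G$ is maximally almost periodic (MAP) if the almost periodic functions (functions $F\circ\iota_b$ with $F:bG\to\mathbb{C}$ continuous) separate the points of $G$, equivalently if $\iota_b$ is injective. A bounded $F:C\to\mathbb{C}$ is $\mu_C$-Riemann integrable if its set of discontinuity points is $\mu_C$-null. $\mathcal{H}(G)$ (Hartman functions) is the set of all $f=F\circ\iota$ with $F$ $\mu_C$-Riemann integrable on some group compactification $(\iota,C)$ of $G$. $\mathcal{H}_0(G)$ is the set of $f\in\mathcal{H}(G)$ such that for some (equivalently, every) group compactification $(\iota,C)$ and $\mu_C$-Riemann integrable $F$ with $f=F\circ\iota$, the set $\{x\in C:F(x)\neq0\}$ is a meager $\mu_C$-null set. $\mathcal{F}_0(G)$ is the set of all bounded (not necessarily continuous or measurable) $f:G\to\mathbb{C}$ vanishing at infinity, i.e. for every $\varepsilon>0$ there is a compact $K\subseteq G$ with $|f(x)|<\varepsilon$ for all $x\in G\setminus K$; $C_0(G)$ is the set of continuous $f\in\mathcal{F}_0(G)$. *)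

theory Defs
  imports "HOL-Analysis.Analysis" "HOL-Algebra.Group"
begin

section \<open>Topological groups and group compactifications\<close>

definition topological_group :: "'a monoid \<Rightarrow> 'a topology \<Rightarrow> bool" where
  "topological_group G T \<longleftrightarrow>
     group G \<and> topspace T = carrier G \<and>
     continuous_map (prod_topology T T) T (\<lambda>(x, y). x \<otimes>\<^bsub>G\<^esub> y) \<and>
     continuous_map T T (\<lambda>x. inv\<^bsub>G\<^esub> x)"

text \<open>A compact topological group is Hausdorff by convention.\<close>

definition compact_topological_group :: "'c monoid \<Rightarrow> 'c topology \<Rightarrow> bool" where
  "compact_topological_group C X \<longleftrightarrow>
     topological_group C X \<and> compact_space X \<and> Hausdorff_space X"

definition group_compactification ::
  "'g monoid \<Rightarrow> 'g topology \<Rightarrow> 'c monoid \<Rightarrow> 'c topology \<Rightarrow> ('g \<Rightarrow> 'c) \<Rightarrow> bool" where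
  "group_compactification G T C X \<iota> \<longleftrightarrow>
     compact_topological_group C X \<and>
     \<iota> \<in> hom G C \<and> continuous_map T X \<iota> \<and>
     X closure_of (\<iota> ` carrier G) = topspace X"

text \<open>
  HOL cannot quantify over types inside a formula, so wherever a definition below ranges over all
  compactifications of a group with elements in \<open>'g\<close>, they are taken on subsets of the type
  \<open>'g set set\<close>.  This is no restriction: by the following lemma every compactification, on any
  type whatsoever, has a topologically isomorphic copy there.
\<close>

lemma group_compactification_copy:
  fixes G :: "'g monoid" and C :: "'c monoid"
  assumes comp: "group_compactification G T C X \<iota>"
  obtains D :: "'g set set monoid" and Y h
  where "group_compactification G T D Y (h \<circ> \<iota>)" "h \<in> iso C D" "homeomorphic_map X Y h"
proof -
  define h where "h = (\<lambda>x. {A. A \<subseteq> carrier G \<and> x \<in> X closure_of (\<iota> ` A)})"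
  have grp: "group C" and top: "topspace X = carrier C"
    and cm: "continuous_map (prod_topology X X) X (\<lambda>(x, y). x \<otimes>\<^bsub>C\<^esub> y)"
    and ci: "continuous_map X X (\<lambda>x. inv\<^bsub>C\<^esub> x)"
    and cpt: "compact_space X" and haus: "Hausdorff_space X"
    and hom: "\<iota> \<in> hom G C" and cont: "continuous_map T X \<iota>"
    and dense: "X closure_of (\<iota> ` carrier G) = topspace X"
    using comp
    by (auto simp: group_compactification_def compact_topological_group_def topological_group_def)
  interpret C: group C by (fact grp)
  have ne: "h x \<noteq> h y" if x: "x \<in> carrier C" and y: "y \<in> carrier C" and xy: "x \<noteq> y" for x y
  proof -
    obtain U V where U: "openin X U" "x \<in> U" and V: "openin X V" "y \<in> V" and d: "disjnt U V"
      using haus x y xy top unfolding Hausdorff_space_def by metis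
    define A where "A = {g \<in> carrier G. \<iota> g \<in> U}"
    have "x \<in> X closure_of (\<iota> ` A)"
      unfolding in_closure_of
    proof (intro conjI allI impI)
      show "x \<in> topspace X" using x top by simp
      fix W assume W: "x \<in> W \<and> openin X W"
      have "x \<in> X closure_of (\<iota> ` carrier G)" using dense x top by simp
      then have "\<exists>z. z \<in> \<iota> ` carrier G \<and> z \<in> W \<inter> U"
        using W U unfolding in_closure_of by (meson IntI openin_Int)
      then show "\<exists>z. z \<in> \<iota> ` A \<and> z \<in> W" unfolding A_def by blast
    qed
    moreover have "y \<notin> X closure_of (\<iota> ` A)"
      unfolding in_closure_of A_def using V d by (force simp: disjnt_iff)
    ultimately have "A \<in> h x" "A \<notin> h y" unfolding h_def A_def by auto
    then show ?thesis by auto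
  qed
  then have inj: "inj_on h (carrier C)" by (auto simp: inj_on_def)
  define g where "g = inv_into (carrier C) h"
  have gh: "g (h x) = x" if "x \<in> carrier C" for x
    using inj that by (simp add: g_def)
  define Y where "Y = pullback_topology (h ` carrier C) g X"
  define D where "D = \<lparr>carrier = h ` carrier C,
    mult = (\<lambda>a b. h (g a \<otimes>\<^bsub>C\<^esub> g b)), one = h \<one>\<^bsub>C\<^esub>\<rparr>"
  have topY: "topspace Y = h ` carrier C"
    unfolding Y_def topspace_pullback_topology using gh top by auto
  have cg: "continuous_map Y X g"
    unfolding Y_def using continuous_map_pullback[of X X id "h ` carrier C" g] by simp
  have ch: "continuous_map X Y h"
    unfolding Y_def
  proof (rule continuous_map_pullback')
    show "continuous_map X X (g \<circ> h)"
      by (rule continuous_map_eq[OF continuous_map_id]) (simp add: gh top)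
    show "topspace X \<subseteq> h -` h ` carrier C" using top by auto
  qed
  have hm: "homeomorphic_maps X Y h g"
    unfolding homeomorphic_maps_def using cg ch gh top topY by auto
  then have homeo: "homeomorphic_map X Y h"
    using homeomorphic_map_maps by blast
  have hs: "X homeomorphic_space Y" using hm homeomorphic_space_def by blast
  have carD: "carrier D = h ` carrier C" by (simp add: D_def)
  have grpD: "group D"
  proof (rule groupI)
    fix a assume "a \<in> carrier D"
    then obtain x where "x \<in> carrier C" "a = h x" by (auto simp: D_def)
    then show "\<exists>b\<in>carrier D. b \<otimes>\<^bsub>D\<^esub> a = \<one>\<^bsub>D\<^esub>"
      by (intro bexI[of _ "h (inv\<^bsub>C\<^esub> x)"]) (auto simp: D_def gh)
  qed (auto simp: D_def gh C.m_assoc)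
  have iso: "h \<in> iso C D"
    unfolding iso_def hom_def bij_betw_def using inj by (auto simp: D_def gh)
  have hhom: "group_hom C D h"
    using grp grpD iso by (simp add: group_hom_def group_hom_axioms_def iso_def)
  have invD: "inv\<^bsub>D\<^esub> a = h (inv\<^bsub>C\<^esub> (g a))" if "a \<in> carrier D" for a
    using that group_hom.hom_inv[OF hhom] by (auto simp: D_def gh)
  have "continuous_map (prod_topology Y Y) Y (\<lambda>(a, b). a \<otimes>\<^bsub>D\<^esub> b)"
  proof -
    have "continuous_map (prod_topology Y Y) (prod_topology X X) (\<lambda>(a, b). (g a, g b))"
      using cg by (auto simp: continuous_map_prod_top)
    then have "continuous_map (prod_topology Y Y) Y
        (h \<circ> ((\<lambda>(x, y). x \<otimes>\<^bsub>C\<^esub> y) \<circ> (\<lambda>(a, b). (g a, g b))))"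
      by (rule continuous_map_compose[OF continuous_map_compose[OF _ cm] ch])
    then show ?thesis
      by (rule continuous_map_eq) (auto simp: D_def)
  qed
  moreover have "continuous_map Y Y (\<lambda>a. inv\<^bsub>D\<^esub> a)"
  proof -
    have "continuous_map Y Y (h \<circ> ((\<lambda>x. inv\<^bsub>C\<^esub> x) \<circ> g))"
      by (rule continuous_map_compose[OF continuous_map_compose[OF cg ci] ch])
    then show ?thesis
      by (rule continuous_map_eq) (simp add: invD topY carD)
  qed
  ultimately have "topological_group D Y"
    using grpD topY by (simp add: topological_group_def D_def)
  moreover have "compact_space Y" "Hausdorff_space Y"
    using cpt haus hs homeomorphic_compact_space homeomorphic_Hausdorff_space by blast+
  moreover have "h \<circ> \<iota> \<in> hom G D"
    using hom iso by (auto simp: iso_def intro: Group.hom_compose)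
  moreover have "continuous_map T Y (h \<circ> \<iota>)"
    by (rule continuous_map_compose[OF cont ch])
  moreover have "Y closure_of ((h \<circ> \<iota>) ` carrier G) = topspace Y"
  proof -
    have "\<iota> ` carrier G \<subseteq> topspace X" using hom top by (auto simp: hom_def)
    then have "Y closure_of (h ` (\<iota> ` carrier G)) = h ` (X closure_of (\<iota> ` carrier G))"
      by (rule homeomorphic_map_closure_of[OF homeo])
    then show ?thesis using dense top topY by (simp add: image_comp)
  qed
  ultimately have "group_compactification G T D Y (h \<circ> \<iota>)"
    by (simp add: group_compactification_def compact_topological_group_def)
  then show thesis using iso homeo that by blast
qed


section \<open>The Bohr compactification and almost periodicity\<close>

definition bohr_compactification ::
  "'g monoid \<Rightarrow> 'g topology \<Rightarrow> 'g set set monoid \<Rightarrow> 'g set set topology \<Rightarrow> ('g \<Rightarrow> 'g set set) \<Rightarrow> bool"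
where
  "bohr_compactification G T B X \<iota> \<longleftrightarrow>
     group_compactification G T B X \<iota> \<and>
     (\<forall>(C :: 'g set set monoid) Y \<kappa>. group_compactification G T C Y \<kappa> \<longrightarrow>
        (\<exists>\<pi>. \<pi> \<in> hom B C \<and> continuous_map X Y \<pi> \<and> (\<forall>x\<in>carrier G. \<kappa> x = \<pi> (\<iota> x))))"

text \<open>
  Functions on a topological group are total functions on the underlying type; in all of the
  following only their values on the carrier matter.
\<close>

definition almost_periodic :: "'g monoid \<Rightarrow> 'g topology \<Rightarrow> ('g \<Rightarrow> complex) \<Rightarrow> bool" where
  "almost_periodic G T f \<longleftrightarrow>
     (\<exists>B X \<iota> F. bohr_compactification G T B X \<iota> \<and> continuous_map X euclidean F \<and>
        (\<forall>x\<in>carrier G. f x = F (\<iota> x)))"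

definition maximally_almost_periodic :: "'g monoid \<Rightarrow> 'g topology \<Rightarrow> bool" where
  "maximally_almost_periodic G T \<longleftrightarrow>
     (\<forall>x\<in>carrier G. \<forall>y\<in>carrier G. x \<noteq> y \<longrightarrow> (\<exists>f. almost_periodic G T f \<and> f x \<noteq> f y))"


section \<open>Haar measure, Riemann integrability and Hartman functions\<close>

text \<open>
  The normalized Haar measure of a compact group, as a regular Borel probability measure; on a
  compact space outer regularity entails inner regularity.  Without regularity a left-invariant
  Borel probability measure need not be unique.
\<close>

definition normalized_haar_measure :: "'c monoid \<Rightarrow> 'c topology \<Rightarrow> 'c measure \<Rightarrow> bool" where
  "normalized_haar_measure C X \<mu> \<longleftrightarrow>
     space \<mu> = topspace X \<and>
     sets \<mu> = sigma_sets (topspace X) {U. openin X U} \<and>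
     emeasure \<mu> (topspace X) = 1 \<and>
     (\<forall>a\<in>carrier C. \<forall>A\<in>sets \<mu>. emeasure \<mu> ((\<lambda>x. a \<otimes>\<^bsub>C\<^esub> x) ` A) = emeasure \<mu> A) \<and>
     (\<forall>A\<in>sets \<mu>. emeasure \<mu> A = (INF U\<in>{U. openin X U \<and> A \<subseteq> U}. emeasure \<mu> U))"

definition riemann_integrable :: "'c topology \<Rightarrow> 'c measure \<Rightarrow> ('c \<Rightarrow> complex) \<Rightarrow> bool" where
  "riemann_integrable X \<mu> F \<longleftrightarrow>
     bounded (F ` topspace X) \<and>
     {x \<in> topspace X. \<not> topcontinuous_at X euclidean F x} \<in> null_sets (completion \<mu>)"

definition nowhere_dense_in :: "'a topology \<Rightarrow> 'a set \<Rightarrow> bool" where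
  "nowhere_dense_in X A \<longleftrightarrow> A \<subseteq> topspace X \<and> X interior_of (X closure_of A) = {}"

definition meager_in :: "'a topology \<Rightarrow> 'a set \<Rightarrow> bool" where
  "meager_in X A \<longleftrightarrow>
     (\<exists>N :: nat \<Rightarrow> 'a set. (\<forall>n. nowhere_dense_in X (N n)) \<and> A = (\<Union>n. N n))"

definition hartman_functions :: "'g monoid \<Rightarrow> 'g topology \<Rightarrow> ('g \<Rightarrow> complex) set" where
  "hartman_functions G T =
     {f. \<exists>(C :: 'g set set monoid) X \<iota> \<mu> F.
           group_compactification G T C X \<iota> \<and> normalized_haar_measure C X \<mu> \<and>
           riemann_integrable X \<mu> F \<and> (\<forall>x\<in>carrier G. f x = F (\<iota> x))}"

definition hartman_functions_0 :: "'g monoid \<Rightarrow> 'g topology \<Rightarrow> ('g \<Rightarrow> complex) set" where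
  "hartman_functions_0 G T =
     {f. \<exists>(C :: 'g set set monoid) X \<iota> \<mu> F.
           group_compactification G T C X \<iota> \<and> normalized_haar_measure C X \<mu> \<and>
           riemann_integrable X \<mu> F \<and> (\<forall>x\<in>carrier G. f x = F (\<iota> x)) \<and>
           meager_in X {x \<in> topspace X. F x \<noteq> 0} \<and>
           {x \<in> topspace X. F x \<noteq> 0} \<in> null_sets (completion \<mu>)}"


section \<open>Functions vanishing at infinity\<close>

definition vanishing_functions :: "'g topology \<Rightarrow> ('g \<Rightarrow> complex) set" where
  "vanishing_functions T =
     {f. bounded (f ` topspace T) \<and>
         (\<forall>\<epsilon>>0. \<exists>K. compactin T K \<and> (\<forall>x\<in>topspace T - K. cmod (f x) < \<epsilon>))}"

definition continuous_vanishing_functions :: "'g topology \<Rightarrow> ('g \<Rightarrow> complex) set" where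
  "continuous_vanishing_functions T =
     {f \<in> vanishing_functions T. continuous_map T euclidean f}"

end

theory Submission
  imports Defs
begin

text \<open>
  Since \<open>G\<close> is maximally almost periodic, it embeds by an injective \<open>\<iota>\<close> into a compact group
  \<open>C\<close>; transport \<open>f\<close> along \<open>\<iota>\<close> and extend it by \<open>0\<close> to a function \<open>F\<close> on \<open>C\<close>.  If \<open>G\<close> is
  compact, then \<open>\<iota>\<close> is a homeomorphism and \<open>F\<close> is continuous.  If \<open>G\<close> is not compact, then
  every compact \<open>K \<subseteq> G\<close> has arbitrarily many pairwise disjoint translates (choose the next
  translating element outside the compact union of the sets \<open>s K K\<^sup>-\<^sup>1\<close>), so the closed set
  \<open>\<iota> K\<close> has Haar measure \<open>0\<close> and therefore empty interior.  As \<open>F\<close> is smaller than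
  \<open>1/(n+1)\<close> off some \<open>\<iota> (K n)\<close>, both its discontinuities and its support lie in the union of
  these countably many sets.

  Haar measure on \<open>C\<close> comes from Haar's covering numbers: the number of left translates of a small
  identity neighbourhood \<open>V\<close> needed to cover a closed set, relative to the number needed for \<open>C\<close>,
  has a cluster point as \<open>V\<close> shrinks, and this is a translation-invariant content on closed sets.
\<close>

section \<open>Regular Borel measures from contents\<close>

text \<open>A content in the sense of Halmos. Closed sets are the compact sets here, and
  \<open>mono\<close> with \<open>total\<close> bounds all values by 1, although they are typed as
  \<open>ennreal\<close> so that suprema and infima always exist.\<close>

locale closed_content =
  fixes X :: "'a topology" and l :: "'a set \<Rightarrow> ennreal"
  assumes compact: "compact_space X" and Hausdorff: "Hausdorff_space X"
    and empty: "l {} = 0"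
    and mono: "\<And>K L. closedin X K \<Longrightarrow> closedin X L \<Longrightarrow> K \<subseteq> L \<Longrightarrow> l K \<le> l L"
    and subadditive: "\<And>K L. closedin X K \<Longrightarrow> closedin X L \<Longrightarrow> l (K \<union> L) \<le> l K + l L"
    and additive: "\<And>K L. closedin X K \<Longrightarrow> closedin X L \<Longrightarrow> disjnt K L \<Longrightarrow> l (K \<union> L) = l K + l L"
    and total: "l (topspace X) = 1"
begin

section \<open>Inner and outer content\<close>

definition inner_content :: "'a set \<Rightarrow> ennreal" where
  "inner_content U = (SUP K\<in>{K. closedin X K \<and> K \<subseteq> U}. l K)"

definition outer_content :: "'a set \<Rightarrow> ennreal" where
  "outer_content A = (INF U\<in>{U. openin X U \<and> A \<subseteq> U}. inner_content U)"

lemma inner_content_upper: "closedin X K \<Longrightarrow> K \<subseteq> U \<Longrightarrow> l K \<le> inner_content U"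
  unfolding inner_content_def by (rule SUP_upper) simp

lemma inner_content_least: "(\<And>K. closedin X K \<Longrightarrow> K \<subseteq> U \<Longrightarrow> l K \<le> b) \<Longrightarrow> inner_content U \<le> b"
  unfolding inner_content_def by (rule SUP_least) simp

lemma inner_content_mono: "U \<subseteq> V \<Longrightarrow> inner_content U \<le> inner_content V"
  by (meson inner_content_least inner_content_upper subset_trans)

lemma inner_content_empty: "inner_content {} = 0"
  using inner_content_least[of "{}" 0] empty by simp

lemma inner_content_topspace: "inner_content (topspace X) = 1"
  using inner_content_upper[of "topspace X"] inner_content_least[of "topspace X" 1] mono[of _ "topspace X"] total
  by (metis antisym closedin_topspace order_refl)

text \<open>By normality, a closed subset of the union splits into two closed pieces, one inside
  each open set, so subadditivity on closed sets applies.\<close>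

lemma inner_content_Un:
  assumes U: "openin X U" and V: "openin X V"
  shows "inner_content (U \<union> V) \<le> inner_content U + inner_content V"
proof (rule inner_content_least)
  fix K assume K: "closedin X K" "K \<subseteq> U \<union> V"
  have "normal_space X"
    using compact Hausdorff compact_Hausdorff_or_regular_imp_normal_space by blast
  \<comment> \<open>The dual form of normality asks for an open cover of the whole space; adding the
    complement of \<open>K\<close> to \<open>V\<close> supplies one without changing anything on
    \<open>K\<close>.\<close>
  moreover have "openin X (V \<union> (topspace X - K))"
    using V K by (auto intro: openin_diff)
  moreover have "U \<union> (V \<union> (topspace X - K)) = topspace X"
    using U V K by (auto dest: openin_subset)
  ultimately obtain S T where ST: "closedin X S" "closedin X T" "S \<subseteq> U"
      "T \<subseteq> V \<union> (topspace X - K)" "S \<union> T = topspace X"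
    using U unfolding normal_space_dual by metis
  have "K = (K \<inter> S) \<union> (K \<inter> T)"
    using ST K closedin_subset[OF K(1)] by blast
  then have "l K \<le> l (K \<inter> S) + l (K \<inter> T)"
    using subadditive[of "K \<inter> S" "K \<inter> T"] K ST by (auto intro: closedin_Int)
  also have "\<dots> \<le> inner_content U + inner_content V"
    using K ST by (intro add_mono inner_content_upper closedin_Int) auto
  finally show "l K \<le> inner_content U + inner_content V" .
qed

lemma inner_content_UN_lessThan:
  fixes U :: "nat \<Rightarrow> 'a set"
  shows "(\<And>i. openin X (U i)) \<Longrightarrow> inner_content (\<Union>i<n. U i) \<le> (\<Sum>i<n. inner_content (U i))"
proof (induction n)
  case (Suc n)
  have "inner_content (\<Union>i<Suc n. U i) \<le> inner_content (\<Union>i<n. U i) + inner_content (U n)"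
    using inner_content_Un[OF openin_Union Suc.prems, of "U ` {..<n}" n] Suc.prems
    by (auto simp: lessThan_Suc Un_commute)
  also have "\<dots> \<le> (\<Sum>i<Suc n. inner_content (U i))"
    using Suc by (simp add: add_right_mono)
  finally show ?case .
qed (simp add: inner_content_empty)

text \<open>A closed \<open>K\<close> inside the union is compact, hence already covered by finitely
  many \<open>U i\<close>.\<close>

lemma inner_content_UN:
  fixes U :: "nat \<Rightarrow> 'a set"
  assumes U: "\<And>i. openin X (U i)"
  shows "inner_content (\<Union>i. U i) \<le> (\<Sum>i. inner_content (U i))"
proof (rule inner_content_least)
  fix K assume K: "closedin X K" "K \<subseteq> (\<Union>i. U i)"
  then have "compactin X K" by (simp add: compact closedin_compact_space)
  then obtain \<F> where \<F>: "finite \<F>" "\<F> \<subseteq> range U" "K \<subseteq> \<Union>\<F>"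
    using K U unfolding compactin_def by (metis (no_types, lifting) image_iff)
  then obtain I where I: "finite I" "\<F> = U ` I"
    by (meson finite_subset_image)
  then obtain n where "I \<subseteq> {..<n}"
    using finite_nat_iff_bounded by blast
  then have "K \<subseteq> (\<Union>i<n. U i)" using \<F> I by blast
  then have "l K \<le> inner_content (\<Union>i<n. U i)" using K inner_content_upper by blast
  also have "\<dots> \<le> (\<Sum>i<n. inner_content (U i))" using U by (rule inner_content_UN_lessThan)
  also have "\<dots> \<le> (\<Sum>i. inner_content (U i))" by (rule sum_le_suminf) auto
  finally show "l K \<le> (\<Sum>i. inner_content (U i))" .
qed

lemma outer_content_lower: "openin X U \<Longrightarrow> A \<subseteq> U \<Longrightarrow> outer_content A \<le> inner_content U"
  unfolding outer_content_def by (rule INF_lower) simp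

lemma outer_content_greatest: "(\<And>U. openin X U \<Longrightarrow> A \<subseteq> U \<Longrightarrow> b \<le> inner_content U) \<Longrightarrow> b \<le> outer_content A"
  unfolding outer_content_def by (rule INF_greatest) simp

lemma outer_content_mono: "A \<subseteq> B \<Longrightarrow> outer_content A \<le> outer_content B"
  by (meson outer_content_greatest outer_content_lower subset_trans)

lemma outer_content_open: "openin X U \<Longrightarrow> outer_content U = inner_content U"
  by (intro antisym outer_content_lower outer_content_greatest inner_content_mono) auto

lemma outer_content_finite:
  assumes "A \<subseteq> topspace X"
  shows "outer_content A \<noteq> \<infinity>"
proof -
  have "outer_content A \<le> 1"
    using outer_content_lower[OF openin_topspace assms] inner_content_topspace by simp
  then show ?thesis by (auto simp: top_unique)
qed

text \<open>Each \<open>A i\<close> gets an open superset that exceeds its outer content by at most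
  e/2^(i+1). Such a superset exists because the outer content is finite, and the errors add up to
  e.\<close>

lemma outer_content_UN:
  fixes A :: "nat \<Rightarrow> 'a set"
  assumes A: "\<And>i. A i \<subseteq> topspace X"
  shows "outer_content (\<Union>i. A i) \<le> (\<Sum>i. outer_content (A i))"
proof (rule ennreal_le_epsilon)
  fix e :: real assume e: "0 < e"
  have "\<exists>U. openin X U \<and> A i \<subseteq> U \<and> inner_content U \<le> outer_content (A i) + ennreal (e * (1/2) ^ Suc i)" for i
  proof -
    have "outer_content (A i) < outer_content (A i) + ennreal (e * (1/2) ^ Suc i)"
      using e outer_content_finite[OF A, of i] by (cases "outer_content (A i)") (auto simp: ennreal_less_iff simp flip: ennreal_plus)
    then show ?thesis
      unfolding outer_content_def[of "A i"] INF_less_iff using less_imp_le by blast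
  qed
  then obtain U where U: "\<And>i. openin X (U i)" "\<And>i. A i \<subseteq> U i"
      "\<And>i. inner_content (U i) \<le> outer_content (A i) + ennreal (e * (1/2) ^ Suc i)"
    by metis
  have "outer_content (\<Union>i. A i) \<le> inner_content (\<Union>i. U i)"
    using U by (intro outer_content_lower openin_Union) blast+
  also have "\<dots> \<le> (\<Sum>i. inner_content (U i))"
    using U(1) by (rule inner_content_UN)
  also have "\<dots> \<le> (\<Sum>i. outer_content (A i) + ennreal (e * (1/2) ^ Suc i))"
    by (intro suminf_le U) auto
  also have "\<dots> = (\<Sum>i. outer_content (A i)) + (\<Sum>i. ennreal (e * (1/2) ^ Suc i))"
    by (rule suminf_add[symmetric]) auto
  also have "(\<Sum>i. ennreal (e * (1/2) ^ Suc i)) = ennreal e"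
    using e sums_mult[OF power_half_series, of e] by (intro suminf_ennreal_eq) auto
  finally show "outer_content (\<Union>i. A i) \<le> (\<Sum>i. outer_content (A i)) + ennreal e" .
qed

lemma outer_content_Un:
  assumes "A \<subseteq> topspace X" "B \<subseteq> topspace X"
  shows "outer_content (A \<union> B) \<le> outer_content A + outer_content B"
proof -
  have e: "outer_content {} = 0" using outer_content_open[of "{}"] inner_content_empty by simp
  have "outer_content (\<Union>i. binaryset A B i) \<le> (\<Sum>i. outer_content (binaryset A B i))"
    using assms by (intro outer_content_UN) (simp add: binaryset_def)
  also have "\<dots> = outer_content A + outer_content B"
    by (rule suminf_binaryset_eq[of outer_content A B]) (fact e)
  finally show ?thesis by (simp add: UN_binaryset_eq)
qed

text \<open>Exhausting first \<open>V \<inter> U\<close> by closed \<open>K\<close>, then \<open>V - K\<close> by closed \<open>L\<close>, makes \<open>K\<close> and \<open>L\<close> disjoint.\<close>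

lemma inner_content_split:
  assumes U: "openin X U" and V: "openin X V"
  shows "inner_content (V \<inter> U) + outer_content (V - U) \<le> inner_content V"
proof -
  have "l K + outer_content (V - U) \<le> inner_content V" if K: "closedin X K" "K \<subseteq> V \<inter> U" for K
  proof -
    have "outer_content (V - U) \<le> inner_content (V - K)"
      using K V by (intro outer_content_lower openin_diff) auto
    then have "l K + outer_content (V - U) \<le> l K + inner_content (V - K)"
      by (rule add_left_mono)
    also have "\<dots> = (SUP L\<in>{L. closedin X L \<and> L \<subseteq> V - K}. l K + l L)"
      unfolding inner_content_def by (subst ennreal_SUP_add_right) auto
    also have "\<dots> \<le> inner_content V"
    proof (rule SUP_least)
      fix L assume "L \<in> {L. closedin X L \<and> L \<subseteq> V - K}"
      then have L: "closedin X L" "L \<subseteq> V - K" by auto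
      then have "l K + l L = l (K \<union> L)"
        using K by (intro additive[symmetric]) (auto simp: disjnt_def)
      also have "\<dots> \<le> inner_content V"
        using K L by (intro inner_content_upper closedin_Un) auto
      finally show "l K + l L \<le> inner_content V" .
    qed
    finally show ?thesis .
  qed
  then have "(SUP K\<in>{K. closedin X K \<and> K \<subseteq> V \<inter> U}. l K + outer_content (V - U)) \<le> inner_content V"
    by (intro SUP_least) auto
  moreover have "(SUP K\<in>{K. closedin X K \<and> K \<subseteq> V \<inter> U}. l K + outer_content (V - U))
      = inner_content (V \<inter> U) + outer_content (V - U)"
    unfolding inner_content_def by (rule ennreal_SUP_add_left) auto
  ultimately show ?thesis by simp
qed

text \<open>This is Caratheodory's measurability condition for open \<open>U\<close>. One inequality
  is subadditivity; the other is \<open>inner_content_split\<close>, applied to every open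
  \<open>V\<close> containing \<open>A\<close>.\<close>

lemma outer_content_split:
  assumes U: "openin X U" and A: "A \<subseteq> topspace X"
  shows "outer_content (A \<inter> U) + outer_content (A - U) = outer_content A"
proof (rule antisym)
  show "outer_content (A \<inter> U) + outer_content (A - U) \<le> outer_content A"
  proof (rule outer_content_greatest)
    fix V assume V: "openin X V" "A \<subseteq> V"
    have "outer_content (A \<inter> U) + outer_content (A - U) \<le> inner_content (V \<inter> U) + outer_content (V - U)"
      using U V by (intro add_mono outer_content_lower outer_content_mono) auto
    also have "\<dots> \<le> inner_content V" using U V(1) by (rule inner_content_split)
    finally show "outer_content (A \<inter> U) + outer_content (A - U) \<le> inner_content V" .
  qed
next
  have "outer_content A = outer_content ((A \<inter> U) \<union> (A - U))" by (simp add: Int_Diff_Un)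
  also have "\<dots> \<le> outer_content (A \<inter> U) + outer_content (A - U)"
    using A by (intro outer_content_Un) auto
  finally show "outer_content A \<le> outer_content (A \<inter> U) + outer_content (A - U)" .
qed

section \<open>The Borel measure of a content and its behaviour under homeomorphisms\<close>

definition borel_measure :: "'a measure" where
  "borel_measure = measure_of (topspace X) {U. openin X U} outer_content"

lemma space_borel_measure: "space borel_measure = topspace X"
  unfolding borel_measure_def by (rule space_measure_of) (auto dest: openin_subset)

lemma sets_borel_measure: "sets borel_measure = sigma_sets (topspace X) {U. openin X U}"
  unfolding borel_measure_def by (rule sets_measure_of) (auto dest: openin_subset)

text \<open>\<open>measure_of\<close> reproduces \<open>outer_content\<close> only once this is
  known to be countably additive. By Caratheodory it is so on the sigma-algebra \<open>?L\<close> of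
  measurable sets, which contains the open sets by \<open>outer_content_split\<close> and therefore
  every Borel set.\<close>

lemma emeasure_borel_measure:
  assumes A: "A \<in> sets borel_measure"
  shows "emeasure borel_measure A = outer_content A"
proof (rule emeasure_measure_of[OF borel_measure_def])
  let ?B = "sigma_sets (topspace X) {U. openin X U}"
  let ?L = "lambda_system (topspace X) (Pow (topspace X)) outer_content"
  interpret sigma_algebra "topspace X" "Pow (topspace X)"
    by (rule sigma_algebra_Pow)
  have "positive (Pow (topspace X)) outer_content"
    using outer_content_open[of "{}"] inner_content_empty by (simp add: positive_def)
  moreover have "increasing (Pow (topspace X)) outer_content"
    by (simp add: increasing_def outer_content_mono)
  moreover have "countably_subadditive (Pow (topspace X)) outer_content"
    unfolding countably_subadditive_def using outer_content_UN by (auto simp: image_subset_iff)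
  ultimately have ms: "measure_space (topspace X) ?L outer_content"
    by (intro caratheodory_lemma) (simp add: outer_measure_space_def)
  have "{U. openin X U} \<subseteq> ?L"
    unfolding lambda_system_eq using outer_content_split by (auto dest: openin_subset)
  then have BL: "?B \<subseteq> ?L"
    using ms sigma_algebra.sigma_sets_subset unfolding measure_space_def by blast
  show "{U. openin X U} \<subseteq> Pow (topspace X)"
    by (auto dest: openin_subset)
  show "A \<in> sets borel_measure" by (fact A)
  show "positive (sets borel_measure) outer_content"
    using ms unfolding measure_space_def positive_def by blast
  show "countably_additive (sets borel_measure) outer_content"
    using ms BL unfolding sets_borel_measure measure_space_def countably_additive_def by blast
qed

lemma emeasure_borel_measure_open: "openin X U \<Longrightarrow> emeasure borel_measure U = inner_content U"
  by (subst emeasure_borel_measure) (auto simp: sets_borel_measure outer_content_open)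

lemma emeasure_borel_measure_topspace: "emeasure borel_measure (topspace X) = 1"
  by (simp add: emeasure_borel_measure_open inner_content_topspace)

lemma borel_measure_outer_regular:
  assumes "A \<in> sets borel_measure"
  shows "emeasure borel_measure A = (INF U\<in>{U. openin X U \<and> A \<subseteq> U}. emeasure borel_measure U)"
  unfolding emeasure_borel_measure[OF assms] outer_content_def
  by (rule INF_cong) (auto simp: emeasure_borel_measure_open)

text \<open>A closed set inside the image of \<open>U\<close> is the image of a closed subset of
  \<open>U\<close> with the same content. One inequality suffices, since the inverse map will give
  the other.\<close>

lemma outer_content_homeomorphic_image:
  assumes h: "homeomorphic_maps X X h g"
    and inv: "\<And>K. closedin X K \<Longrightarrow> l (h ` K) = l K"
    and A: "A \<subseteq> topspace X"
  shows "outer_content (h ` A) \<le> outer_content A"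
proof (rule outer_content_greatest)
  fix U assume U: "openin X U" "A \<subseteq> U"
  have hg: "\<And>x. x \<in> topspace X \<Longrightarrow> g (h x) = x" "\<And>x. x \<in> topspace X \<Longrightarrow> h (g x) = x"
    and hh: "homeomorphic_map X X h" and gh: "homeomorphic_map X X g"
    using h by (auto simp: homeomorphic_maps_map)
  have "outer_content (h ` A) \<le> inner_content (h ` U)"
    using U hh homeomorphic_imp_open_map[OF hh]
    by (intro outer_content_lower image_mono) (simp_all add: open_map_def)
  also have "\<dots> \<le> inner_content U"
  proof (rule inner_content_least)
    fix K assume K: "closedin X K" "K \<subseteq> h ` U"
    have "closedin X (g ` K)"
      using gh K(1) homeomorphic_imp_closed_map closed_map_def by metis
    moreover have "g ` K \<subseteq> U"
      using K(2) openin_subset[OF U(1)] hg(1) by force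
    moreover have "h ` (g ` K) = K"
      using closedin_subset[OF K(1)] hg(2) by (force simp: image_iff)
    ultimately show "l K \<le> inner_content U"
      using inv[of "g ` K"] inner_content_upper by metis
  qed
  finally show "outer_content (h ` A) \<le> inner_content U" .
qed

text \<open>The image under \<open>h\<close> is the preimage under the continuous inverse
  \<open>g\<close>.\<close>

lemma homeomorphic_image_in_sets:
  assumes h: "homeomorphic_maps X X h g"
    and A: "A \<in> sets borel_measure"
  shows "h ` A \<in> sets borel_measure"
proof -
  have g: "continuous_map X X g" and hg: "h ` topspace X = topspace X"
      "\<And>x. x \<in> topspace X \<Longrightarrow> g (h x) = x" "\<And>x. x \<in> topspace X \<Longrightarrow> h (g x) = x"
    using h homeomorphic_imp_surjective_map[of X X h]
    unfolding homeomorphic_maps_map by (simp_all add: homeomorphic_imp_continuous_map)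
  \<comment> \<open>The target is \<open>borel_measure\<close> unfolded, so that measurability has
    to be checked on open sets only.\<close>
  have "g \<in> borel_measure \<rightarrow>\<^sub>M measure_of (topspace X) {U. openin X U} outer_content"
  proof (rule measurable_measure_of)
    show "{U. openin X U} \<subseteq> Pow (topspace X)" by (auto dest: openin_subset)
    show "g \<in> space borel_measure \<rightarrow> topspace X"
      using continuous_map_funspace[OF g] by (simp add: space_borel_measure)
    fix U assume "U \<in> {U. openin X U}"
    then have "openin X {x \<in> topspace X. g x \<in> U}"
      using openin_continuous_map_preimage[OF g] by simp
    moreover have "g -` U \<inter> space borel_measure = {x \<in> topspace X. g x \<in> U}"
      by (auto simp: space_borel_measure)
    ultimately show "g -` U \<inter> space borel_measure \<in> sets borel_measure"
      by (simp add: sets_borel_measure sigma_sets.Basic)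
  qed
  then have "g -` A \<inter> space borel_measure \<in> sets borel_measure"
    using A measurable_sets unfolding borel_measure_def by blast
  moreover have "A \<subseteq> topspace X"
    using sets.sets_into_space[OF A] space_borel_measure by simp
  then have "g -` A \<inter> space borel_measure = h ` A"
    using hg by (force simp: space_borel_measure image_iff)
  ultimately show ?thesis by simp
qed

lemma emeasure_homeomorphic_image:
  assumes h: "homeomorphic_maps X X h g"
    and inv: "\<And>K. closedin X K \<Longrightarrow> l (h ` K) = l K"
    and A: "A \<in> sets borel_measure"
  shows "emeasure borel_measure (h ` A) = emeasure borel_measure A"
proof -
  have AX: "A \<subseteq> topspace X"
    using sets.sets_into_space[OF A] space_borel_measure by simp
  have hg: "homeomorphic_map X X h" "homeomorphic_map X X g"
    "\<And>x. x \<in> topspace X \<Longrightarrow> g (h x) = x" "\<And>x. x \<in> topspace X \<Longrightarrow> h (g x) = x"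
    using h by (auto simp: homeomorphic_maps_map)
  have hAX: "h ` A \<subseteq> topspace X"
    using AX homeomorphic_imp_surjective_map[OF hg(1)] by blast
  have inv': "l (g ` K) = l K" if K: "closedin X K" for K
  proof -
    have "closedin X (g ` K)"
      using homeomorphic_imp_closed_map[OF hg(2)] K by (simp add: closed_map_def)
    moreover have "h ` g ` K = K"
      using closedin_subset[OF K] hg(4) by (force simp: image_iff)
    ultimately show ?thesis using inv[of "g ` K"] by simp
  qed
  have "g ` h ` A = A"
    using AX hg(3) by (force simp: image_iff)
  then have "outer_content A \<le> outer_content (h ` A)"
    using outer_content_homeomorphic_image[OF _ inv' hAX] h homeomorphic_maps_sym by metis
  moreover have "outer_content (h ` A) \<le> outer_content A"
    using outer_content_homeomorphic_image[OF h inv AX] by simp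
  ultimately show ?thesis
    using emeasure_borel_measure A homeomorphic_image_in_sets[OF h A] by simp
qed

end

section \<open>Existence of the Haar measure on a compact group\<close>

locale compact_group = group C for C :: "'c monoid" (structure) +
  fixes X :: "'c topology"
  assumes compact_topological_group: "compact_topological_group C X"
begin

lemma topspace_eq: "topspace X = carrier C"
  and continuous_mult: "continuous_map (prod_topology X X) X (\<lambda>(x, y). x \<otimes> y)"
  and continuous_inv: "continuous_map X X (\<lambda>x. inv x)"
  and compact: "compact_space X"
  and Hausdorff: "Hausdorff_space X"
  using compact_topological_group
  by (auto simp: compact_topological_group_def topological_group_def)

lemma homeomorphic_translation:
  assumes a: "a \<in> carrier C"
  shows "homeomorphic_maps X X (\<lambda>x. a \<otimes> x) (\<lambda>x. inv a \<otimes> x)"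
proof -
  have "continuous_map X X (\<lambda>x. b \<otimes> x)" if b: "b \<in> carrier C" for b
  proof -
    have "continuous_map X (prod_topology X X) (\<lambda>x. (b, x))"
      using b topspace_eq by (simp add: continuous_map_paired)
    from continuous_map_compose[OF this continuous_mult] show ?thesis
      by (simp add: o_def)
  qed
  then show ?thesis
    using a by (simp add: homeomorphic_maps_def topspace_eq flip: m_assoc)
qed

lemma translation_image_subset: "a \<in> carrier C \<Longrightarrow> K \<subseteq> carrier C \<Longrightarrow> (\<lambda>x. a \<otimes> x) ` K \<subseteq> carrier C"
  by auto

lemma openin_translation:
  assumes "a \<in> carrier C" "openin X U"
  shows "openin X ((\<lambda>x. a \<otimes> x) ` U)"
  using homeomorphic_translation[OF assms(1)] assms(2) homeomorphic_imp_open_map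
  unfolding homeomorphic_maps_map open_map_def by blast

lemma translation_inverse_image:
  assumes "a \<in> carrier C" "K \<subseteq> carrier C"
  shows "(\<lambda>x. inv a \<otimes> x) ` (\<lambda>x. a \<otimes> x) ` K = K"
proof -
  have "inv a \<otimes> (a \<otimes> x) = x" if "x \<in> K" for x
    using that assms by (simp add: subset_iff flip: m_assoc)
  then show ?thesis by (simp add: image_image)
qed

lemma continuous_left_quotient:
  "continuous_map (prod_topology X X) X (\<lambda>(x, y). inv x \<otimes> y)"
proof -
  have "continuous_map (prod_topology X X) (prod_topology X X) (\<lambda>z. (inv (fst z), snd z))"
    using continuous_map_compose[OF continuous_map_fst continuous_inv]
    by (simp add: continuous_map_paired continuous_map_snd o_def)
  from continuous_map_compose[OF this continuous_mult] show ?thesis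
    by (simp add: o_def case_prod_unfold)
qed

section \<open>Haar's covering numbers\<close>

definition identity_neighbourhood :: "'c set \<Rightarrow> bool" where
  "identity_neighbourhood V \<longleftrightarrow> openin X V \<and> \<one> \<in> V"

definition translates_cover :: "'c set \<Rightarrow> 'c set \<Rightarrow> 'c set \<Rightarrow> bool" where
  "translates_cover V S K \<longleftrightarrow>
     finite S \<and> S \<subseteq> carrier C \<and> K \<subseteq> (\<Union>s\<in>S. (\<lambda>x. s \<otimes> x) ` V)"

text \<open>Haar's index (K : V). \<open>LEAST\<close> makes it total, but it is meaningful only
  where a finite cover exists; \<open>covering_number_attained\<close> secures this.\<close>

definition covering_number :: "'c set \<Rightarrow> 'c set \<Rightarrow> nat" where
  "covering_number V K = (LEAST n. \<exists>S. translates_cover V S K \<and> card S = n)"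

lemma translates_cover_subset:
  "translates_cover V S L \<Longrightarrow> K \<subseteq> L \<Longrightarrow> translates_cover V S K"
  unfolding translates_cover_def by (meson subset_trans)

text \<open>For a fixed \<open>v\<close> in \<open>V\<close>, each \<open>x\<close> lies in the
  translate of \<open>V\<close> by \<open>x \<otimes> inv v\<close>; compactness then leaves
  finitely many translates. \<open>V\<close> need not contain the identity, so the lemma also serves
  to show that nonempty open sets have positive measure.\<close>

lemma translates_cover_carrier:
  assumes V: "openin X V" "V \<noteq> {}"
  shows "\<exists>S. translates_cover V S (carrier C)"
proof -
  obtain v where v: "v \<in> V" using V(2) by blast
  have vC: "v \<in> carrier C" using v openin_subset[OF V(1)] topspace_eq by auto
  define \<U> where "\<U> = (\<lambda>s. (\<lambda>x. s \<otimes> x) ` V) ` carrier C"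
  have "compactin X (carrier C)"
    using compact topspace_eq by (simp add: compact_space_def)
  moreover have "openin X U" if "U \<in> \<U>" for U
    using that openin_translation V(1) unfolding \<U>_def by blast
  moreover have "carrier C \<subseteq> \<Union>\<U>"
  proof
    fix x assume x: "x \<in> carrier C"
    then have "x = (x \<otimes> inv v) \<otimes> v" using vC by (simp add: m_assoc)
    then show "x \<in> \<Union>\<U>"
      using x v vC unfolding \<U>_def by blast
  qed
  ultimately obtain \<F> where \<F>: "finite \<F>" "\<F> \<subseteq> \<U>" "carrier C \<subseteq> \<Union>\<F>"
    using compactinD[of X "carrier C" \<U>] by blast
  then obtain S where "S \<subseteq> carrier C" "finite S" "\<F> = (\<lambda>s. (\<lambda>x. s \<otimes> x) ` V) ` S"
    unfolding \<U>_def by (meson finite_subset_image)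
  then show ?thesis using \<F>(3) unfolding translates_cover_def by blast
qed

lemma covering_number_le: "translates_cover V S K \<Longrightarrow> covering_number V K \<le> card S"
  unfolding covering_number_def by (rule Least_le) blast

lemma covering_number_attained:
  assumes V: "identity_neighbourhood V" and K: "K \<subseteq> carrier C"
  obtains S where "translates_cover V S K" "card S = covering_number V K"
proof -
  have "openin X V" "V \<noteq> {}" using V by (auto simp: identity_neighbourhood_def)
  then obtain S where "translates_cover V S (carrier C)"
    using translates_cover_carrier by blast
  then have "\<exists>S. translates_cover V S K" using translates_cover_subset K by blast
  then have "\<exists>n S. translates_cover V S K \<and> card S = n" by blast
  then have "\<exists>S. translates_cover V S K \<and> card S = covering_number V K"
    unfolding covering_number_def by (rule LeastI_ex)
  then show thesis using that by blast
qed

lemma covering_number_empty: "covering_number V {} = 0"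
  using covering_number_le[of V "{}" "{}"] by (simp add: translates_cover_def)

lemma covering_number_mono:
  assumes "identity_neighbourhood V" "L \<subseteq> carrier C" "K \<subseteq> L"
  shows "covering_number V K \<le> covering_number V L"
proof -
  obtain S where "translates_cover V S L" "card S = covering_number V L"
    using covering_number_attained assms by blast
  then show ?thesis
    using covering_number_le translates_cover_subset assms(3) by metis
qed

lemma covering_number_Un_le:
  assumes "identity_neighbourhood V" "K \<subseteq> carrier C" "L \<subseteq> carrier C"
  shows "covering_number V (K \<union> L) \<le> covering_number V K + covering_number V L"
proof -
  obtain S where S: "translates_cover V S K" "card S = covering_number V K"
    using covering_number_attained assms by blast
  obtain T where T: "translates_cover V T L" "card T = covering_number V L"
    using covering_number_attained assms by blast
  have "translates_cover V (S \<union> T) (K \<union> L)"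
    using S T by (auto simp: translates_cover_def)
  then have "covering_number V (K \<union> L) \<le> card (S \<union> T)" by (rule covering_number_le)
  also have "\<dots> \<le> card S + card T" by (rule card_Un_le)
  finally show ?thesis using S T by simp
qed

text \<open>In a minimal cover of the union, the translates meeting \<open>K\<close> cover
  \<open>K\<close> and those meeting \<open>L\<close> cover \<open>L\<close>. By \<open>sep\<close>
  no translate is counted twice.\<close>

lemma covering_number_Un_separated:
  assumes V: "identity_neighbourhood V" and KL: "K \<subseteq> carrier C" "L \<subseteq> carrier C"
    and sep: "\<And>s. s \<in> carrier C \<Longrightarrow> disjnt ((\<lambda>x. s \<otimes> x) ` V) K \<or> disjnt ((\<lambda>x. s \<otimes> x) ` V) L"
  shows "covering_number V (K \<union> L) = covering_number V K + covering_number V L"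
proof (rule antisym[OF covering_number_Un_le[OF V KL]])
  obtain S where S: "translates_cover V S (K \<union> L)" "card S = covering_number V (K \<union> L)"
    using covering_number_attained V KL by (metis Un_least)
  define T where "T = (\<lambda>M. {s \<in> S. \<not> disjnt ((\<lambda>x. s \<otimes> x) ` V) M})"
  have fin: "finite S" "S \<subseteq> carrier C" using S(1) by (auto simp: translates_cover_def)
  have "translates_cover V (T K) K" "translates_cover V (T L) L"
    using S(1) unfolding translates_cover_def T_def disjnt_def by fastforce+
  then have "covering_number V K + covering_number V L \<le> card (T K) + card (T L)"
    by (intro add_mono covering_number_le)
  also have "\<dots> = card (T K \<union> T L)"
    using sep fin by (intro card_Un_disjoint[symmetric]) (auto simp: T_def)
  also have "\<dots> \<le> card S"
    using fin by (intro card_mono) (auto simp: T_def)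
  finally show "covering_number V K + covering_number V L \<le> covering_number V (K \<union> L)"
    using S(2) by simp
qed

text \<open>Translating a cover of \<open>M\<close> by \<open>b\<close> covers the translate of
  \<open>M\<close>, which gives one inequality; using it for \<open>a\<close> and for
  \<open>inv a\<close> gives both.\<close>

lemma covering_number_translation:
  assumes V: "identity_neighbourhood V" and a: "a \<in> carrier C" and K: "K \<subseteq> carrier C"
  shows "covering_number V ((\<lambda>x. a \<otimes> x) ` K) = covering_number V K"
proof -
  have le: "covering_number V ((\<lambda>x. b \<otimes> x) ` M) \<le> covering_number V M"
    if b: "b \<in> carrier C" and M: "M \<subseteq> carrier C" for b M
  proof -
    obtain S where S: "translates_cover V S M" "card S = covering_number V M"
      using covering_number_attained V M by blast
    have VC: "V \<subseteq> carrier C"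
      using V openin_subset topspace_eq unfolding identity_neighbourhood_def by blast
    have SC: "S \<subseteq> carrier C" "finite S" using S(1) by (auto simp: translates_cover_def)
    have "(\<lambda>x. b \<otimes> x) ` M \<subseteq> (\<Union>s\<in>(\<lambda>x. b \<otimes> x) ` S. (\<lambda>x. s \<otimes> x) ` V)"
    proof
      fix y assume "y \<in> (\<lambda>x. b \<otimes> x) ` M"
      then obtain s v where sv: "s \<in> S" "v \<in> V" "y = b \<otimes> (s \<otimes> v)"
        using S(1) unfolding translates_cover_def by blast
      then have "y = (b \<otimes> s) \<otimes> v" using b SC VC by (simp add: m_assoc subset_iff)
      then show "y \<in> (\<Union>s\<in>(\<lambda>x. b \<otimes> x) ` S. (\<lambda>x. s \<otimes> x) ` V)" using sv by blast
    qed
    then have "translates_cover V ((\<lambda>x. b \<otimes> x) ` S) ((\<lambda>x. b \<otimes> x) ` M)"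
      using SC b by (auto simp: translates_cover_def)
    then have "covering_number V ((\<lambda>x. b \<otimes> x) ` M) \<le> card ((\<lambda>x. b \<otimes> x) ` S)"
      by (rule covering_number_le)
    also have "\<dots> \<le> card S" using SC by (intro card_image_le)
    finally show ?thesis using S(2) by simp
  qed
  show ?thesis
    using le[OF a K] le[OF inv_closed[OF a] translation_image_subset[OF a K]]
    unfolding translation_inverse_image[OF a K] by (rule antisym)
qed

lemma covering_number_carrier_pos:
  assumes V: "identity_neighbourhood V"
  shows "0 < covering_number V (carrier C)"
proof -
  obtain S where "translates_cover V S (carrier C)" "card S = covering_number V (carrier C)"
    using covering_number_attained V by blast
  moreover from this have "S \<noteq> {}" unfolding translates_cover_def by auto
  ultimately show ?thesis unfolding translates_cover_def by (metis card_gt_0_iff)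
qed

text \<open>The set of left quotients of \<open>K\<close> by \<open>L\<close> is closed and misses the identity; take
  \<open>V\<close> so small that it misses the left quotients of \<open>V\<close> by \<open>V\<close> as well.\<close>

lemma separating_identity_neighbourhood:
  assumes K: "closedin X K" and L: "closedin X L" and KL: "disjnt K L"
  obtains V where "identity_neighbourhood V"
    "\<And>s W. s \<in> carrier C \<Longrightarrow> W \<subseteq> V \<Longrightarrow> disjnt ((\<lambda>x. s \<otimes> x) ` W) K \<or> disjnt ((\<lambda>x. s \<otimes> x) ` W) L"
proof -
  define q where "q = (\<lambda>(x, y). inv x \<otimes> y)"
  have q: "continuous_map (prod_topology X X) X q"
    unfolding q_def by (rule continuous_left_quotient)
  define D where "D = q ` (K \<times> L)"
  have sub: "K \<subseteq> carrier C" "L \<subseteq> carrier C"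
    using K L closedin_subset topspace_eq by auto
  have "compactin (prod_topology X X) (K \<times> L)"
    using K L compact by (simp add: compactin_Times closedin_compact_space)
  then have "closedin X D"
    unfolding D_def using image_compactin[OF _ q] compactin_imp_closedin Hausdorff by blast
  then have O: "openin (prod_topology X X) {z \<in> topspace (prod_topology X X). q z \<in> topspace X - D}"
    by (intro openin_continuous_map_preimage[OF q]) auto
  have "\<one> \<notin> D"
  proof
    assume "\<one> \<in> D"
    then obtain x y where xy: "x \<in> K" "y \<in> L" "inv x \<otimes> y = \<one>" by (auto simp: D_def q_def)
    then have "y = x" using sub by (metis inv_equality inv_inv inv_closed subsetD)
    then show False using xy KL by (auto simp: disjnt_def)
  qed
  then have "(\<one>, \<one>) \<in> {z \<in> topspace (prod_topology X X). q z \<in> topspace X - D}"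
    by (simp add: topspace_eq q_def)
  then obtain A B where AB: "openin X A" "openin X B" "\<one> \<in> A" "\<one> \<in> B"
      "A \<times> B \<subseteq> {z \<in> topspace (prod_topology X X). q z \<in> topspace X - D}"
    using O unfolding openin_prod_topology_alt by meson
  show thesis
  proof
    show "identity_neighbourhood (A \<inter> B)"
      using AB by (auto simp: identity_neighbourhood_def)
    \<comment> \<open>Every \<open>W\<close> inside the neighbourhood is allowed because the limit
      argument needs separation for all sufficiently small neighbourhoods, not just for one.\<close>
    fix s W assume s: "s \<in> carrier C" and W: "W \<subseteq> A \<inter> B"
    show "disjnt ((\<lambda>x. s \<otimes> x) ` W) K \<or> disjnt ((\<lambda>x. s \<otimes> x) ` W) L"
    proof (rule ccontr)
      assume "\<not> ?thesis"
      then obtain v w where vw: "v \<in> W" "w \<in> W" "s \<otimes> v \<in> K" "s \<otimes> w \<in> L"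
        by (auto simp: disjnt_def)
      have vwC: "v \<in> carrier C" "w \<in> carrier C"
        using vw W AB(1) openin_subset topspace_eq by blast+
      have "inv (s \<otimes> v) \<otimes> (s \<otimes> w) \<in> D"
        using vw unfolding D_def q_def by force
      \<comment> \<open>The left quotient does not change when both entries are translated by
        \<open>s\<close>.\<close>
      moreover have "inv (s \<otimes> v) \<otimes> (s \<otimes> w) = inv v \<otimes> (inv s \<otimes> (s \<otimes> w))"
        using s vwC by (simp add: inv_mult_group m_assoc)
      moreover have "inv s \<otimes> (s \<otimes> w) = w"
        using s vwC by (simp flip: m_assoc)
      ultimately have "q (v, w) \<in> D" by (simp add: q_def)
      moreover have "(v, w) \<in> A \<times> B" using vw W by auto
      ultimately show False using AB(5) by blast
    qed
  qed
qed

text \<open>Intersecting with the carrier keeps the value in [0,1] for every set of the type, so the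
  whole function is a point of a product of unit intervals.\<close>

definition relative_covering_number :: "'c set \<Rightarrow> 'c set \<Rightarrow> real" where
  "relative_covering_number V K =
     real (covering_number V (K \<inter> carrier C)) / real (covering_number V (carrier C))"

lemma relative_covering_number_bounds:
  assumes V: "identity_neighbourhood V"
  shows "relative_covering_number V K \<in> {0..1}"
  using covering_number_mono[OF V, of "carrier C" "K \<inter> carrier C"] covering_number_carrier_pos[OF V]
  by (auto simp: relative_covering_number_def divide_le_eq_1)

text \<open>Tychonoff's theorem provides a cluster point of the relative covering numbers as the
  neighbourhood \<open>V\<close> shrinks to the identity.\<close>

lemma covering_number_limit:
  obtains l :: "'c set \<Rightarrow> real" where
    "\<And>W P. identity_neighbourhood W \<Longrightarrow> closed P \<Longrightarrow>
      (\<And>V. identity_neighbourhood V \<Longrightarrow> V \<subseteq> W \<Longrightarrow> relative_covering_number V \<in> P) \<Longrightarrow> l \<in> P"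
proof -
  \<comment> \<open>\<open>T W\<close> collects the values for all neighbourhoods below
    \<open>W\<close>. The closures of these tails have the finite intersection property in the
    compact cube \<open>?S\<close>, and \<open>l\<close> is a common point.\<close>
  define T where "T = (\<lambda>W. relative_covering_number ` {V. identity_neighbourhood V \<and> V \<subseteq> W})"
  let ?S = "PiE UNIV (\<lambda>_::'c set. {0..1::real})"
  have "compactin (product_topology (\<lambda>_::'c set. euclidean) UNIV) ?S"
    unfolding compactin_PiE by simp
  then have cpt: "compact ?S"
    by (simp add: euclidean_product_topology)
  have "?S \<inter> \<Inter>((\<lambda>W. closure (T W)) ` {W. identity_neighbourhood W}) \<noteq> {}"
  proof (rule compact_imp_fip[OF cpt])
    fix F' assume F': "finite F'" "F' \<subseteq> (\<lambda>W. closure (T W)) ` {W. identity_neighbourhood W}"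
    then obtain \<W> where W: "\<W> \<subseteq> {W. identity_neighbourhood W}" "finite \<W>"
        "F' = (\<lambda>W. closure (T W)) ` \<W>"
      by (meson finite_subset_image)
    \<comment> \<open>The carrier is included for the case that \<open>\<W>\<close> is empty, where
      the intersection would be the whole type.\<close>
    define V where "V = carrier C \<inter> \<Inter>\<W>"
    have "openin X (\<Inter>(insert (carrier C) \<W>))"
      using W topspace_eq by (intro openin_Inter) (auto simp: identity_neighbourhood_def simp flip: topspace_eq)
    then have V: "identity_neighbourhood V"
      using W(1) by (auto simp: V_def identity_neighbourhood_def)
    have "relative_covering_number V \<in> T W" if "W \<in> \<W>" for W
      using V that unfolding T_def V_def by blast
    then have "relative_covering_number V \<in> \<Inter>F'"
      using closure_subset unfolding W(3) by blast
    moreover have "relative_covering_number V \<in> ?S"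
      using relative_covering_number_bounds[OF V] by (auto simp: PiE_UNIV_domain)
    ultimately show "?S \<inter> \<Inter>F' \<noteq> {}" by blast
  qed auto
  then obtain l where l: "\<And>W. identity_neighbourhood W \<Longrightarrow> l \<in> closure (T W)" by blast
  show thesis
  proof
    fix W P assume "identity_neighbourhood W" "closed P"
      "\<And>V. identity_neighbourhood V \<Longrightarrow> V \<subseteq> W \<Longrightarrow> relative_covering_number V \<in> P"
    then show "l \<in> P"
      using l[of W] closure_minimal[of "T W" P] unfolding T_def by blast
  qed
qed

text \<open>Evaluation at a set is continuous in the product topology, so each required equality or
  weak inequality between values defines a closed set and passes to \<open>l\<close>. All of them
  hold for every identity neighbourhood except additivity, which needs neighbourhoods small enough
  to separate the two sets.\<close>

lemma invariant_content:
  obtains l :: "'c set \<Rightarrow> ennreal" where "closed_content X l"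
    "\<And>a K. a \<in> carrier C \<Longrightarrow> closedin X K \<Longrightarrow> l ((\<lambda>x. a \<otimes> x) ` K) = l K"
proof -
  obtain l where lim: "\<And>W P. identity_neighbourhood W \<Longrightarrow> closed P \<Longrightarrow>
      (\<And>V. identity_neighbourhood V \<Longrightarrow> V \<subseteq> W \<Longrightarrow> relative_covering_number V \<in> P) \<Longrightarrow> l \<in> P"
    using covering_number_limit by blast
  have nb: "identity_neighbourhood (carrier C)"
    using openin_topspace[of X] topspace_eq by (simp add: identity_neighbourhood_def)
  have sub: "K \<inter> carrier C = K" "K \<subseteq> carrier C" if "closedin X K" for K
    using closedin_subset[OF that] topspace_eq by auto
  note coord = continuous_on_product_coordinates
  have nonneg: "0 \<le> l K" for K
  proof -
    have "l \<in> {f. 0 \<le> f K}"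
      using relative_covering_number_bounds
      by (intro lim[OF nb] closed_Collect_le continuous_on_const coord) auto
    then show ?thesis by simp
  qed
  have empty: "l {} = 0"
  proof -
    have "l \<in> {f. f {} = 0}"
      by (intro lim[OF nb] closed_Collect_eq continuous_on_const coord)
         (auto simp: relative_covering_number_def covering_number_empty)
    then show ?thesis by simp
  qed
  have total: "l (carrier C) = 1"
  proof -
    have "l \<in> {f. f (carrier C) = 1}"
      using covering_number_carrier_pos
      by (intro lim[OF nb] closed_Collect_eq continuous_on_const coord)
         (auto simp: relative_covering_number_def)
    then show ?thesis by simp
  qed
  have mono: "l K \<le> l L" if "closedin X K" "closedin X L" "K \<subseteq> L" for K L
  proof -
    have "l \<in> {f. f K \<le> f L}"
      using that sub covering_number_mono
      by (intro lim[OF nb] closed_Collect_le coord)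
         (auto simp: relative_covering_number_def intro!: divide_right_mono)
    then show ?thesis by simp
  qed
  have subadd: "l (K \<union> L) \<le> l K + l L" if "closedin X K" "closedin X L" for K L
  proof -
    have "relative_covering_number V (K \<union> L)
        \<le> relative_covering_number V K + relative_covering_number V L"
      if V: "identity_neighbourhood V" for V
      using covering_number_Un_le[OF V, of K L] sub[OF closedin_Un] sub \<open>closedin X K\<close> \<open>closedin X L\<close>
      by (simp add: relative_covering_number_def divide_right_mono flip: add_divide_distrib of_nat_add)
    then have "l \<in> {f. f (K \<union> L) \<le> f K + f L}"
      by (intro lim[OF nb] closed_Collect_le continuous_on_add coord) auto
    then show ?thesis by simp
  qed
  have add: "l (K \<union> L) = l K + l L" if KL: "closedin X K" "closedin X L" "disjnt K L" for K L
  proof -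
    obtain W where W: "identity_neighbourhood W" 
      "\<And>s V. s \<in> carrier C \<Longrightarrow> V \<subseteq> W \<Longrightarrow> disjnt ((\<lambda>x. s \<otimes> x) ` V) K \<or> disjnt ((\<lambda>x. s \<otimes> x) ` V) L"
      using separating_identity_neighbourhood[OF KL] by blast
    have "relative_covering_number V (K \<union> L)
        = relative_covering_number V K + relative_covering_number V L"
      if V: "identity_neighbourhood V" "V \<subseteq> W" for V
      using covering_number_Un_separated[OF V(1) sub(2) sub(2), OF KL(1,2) W(2)[OF _ V(2)]]
        sub(1)[OF closedin_Un] sub(1) KL
      by (simp add: relative_covering_number_def add_divide_distrib)
    then have "l \<in> {f. f (K \<union> L) = f K + f L}"
      by (intro lim[OF W(1)] closed_Collect_eq continuous_on_add coord) auto
    then show ?thesis by simp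
  qed
  have inv: "l ((\<lambda>x. a \<otimes> x) ` K) = l K" if a: "a \<in> carrier C" and K: "closedin X K" for a K
  proof -
    have "(\<lambda>x. a \<otimes> x) ` K \<inter> carrier C = (\<lambda>x. a \<otimes> x) ` K"
      using translation_image_subset[OF a sub(2)[OF K]] by blast
    then have "l \<in> {f. f ((\<lambda>x. a \<otimes> x) ` K) = f K}"
      using covering_number_translation[OF _ a sub(2)[OF K]] sub(1)[OF K]
      by (intro lim[OF nb] closed_Collect_eq coord) (simp add: relative_covering_number_def)
    then show ?thesis by simp
  qed
  \<comment> \<open>The limit was taken among real functions; \<open>nonneg\<close> makes the
    passage to \<open>ennreal\<close> additive.\<close>
  have "closed_content X (\<lambda>K. ennreal (l K))"
    by unfold_locales
       (use compact Hausdorff empty total mono subadd add nonneg topspace_eq in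
         \<open>simp_all add: ennreal_leI flip: ennreal_plus\<close>)
  then show thesis using inv that by simp
qed

text \<open>Left translations are homeomorphisms preserving the content, hence they preserve the
  induced regular Borel measure.\<close>

lemma haar_measure_exists:
  obtains \<mu> where "normalized_haar_measure C X \<mu>"
proof -
  obtain l where "closed_content X l"
    and inv: "\<And>a K. a \<in> carrier C \<Longrightarrow> closedin X K \<Longrightarrow> l ((\<lambda>x. a \<otimes> x) ` K) = l K"
    using invariant_content by blast
  then interpret closed_content X l by simp
  have "normalized_haar_measure C X borel_measure"
    unfolding normalized_haar_measure_def
  proof (intro conjI ballI)
    show "emeasure borel_measure ((\<lambda>x. a \<otimes> x) ` A) = emeasure borel_measure A"
      if "a \<in> carrier C" "A \<in> sets borel_measure" for a A
      using that by (intro emeasure_homeomorphic_image[OF homeomorphic_translation inv])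
  qed (rule space_borel_measure sets_borel_measure emeasure_borel_measure_topspace
      borel_measure_outer_regular; assumption?)+
  then show thesis by (rule that)
qed

end

section \<open>Null sets of the Haar measure\<close>

locale haar_measure = compact_group C X for C :: "'c monoid" (structure) and X :: "'c topology" +
  fixes \<mu> :: "'c measure"
  assumes haar: "normalized_haar_measure C X \<mu>"
begin

lemma sets_haar: "sets \<mu> = sigma_sets (topspace X) {U. openin X U}"
  and space_haar: "space \<mu> = topspace X"
  and emeasure_haar_carrier: "emeasure \<mu> (carrier C) = 1"
  and emeasure_translation:
    "a \<in> carrier C \<Longrightarrow> A \<in> sets \<mu> \<Longrightarrow> emeasure \<mu> ((\<lambda>x. a \<otimes> x) ` A) = emeasure \<mu> A"
  using haar topspace_eq by (auto simp: normalized_haar_measure_def)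

lemma open_in_sets: "openin X U \<Longrightarrow> U \<in> sets \<mu>"
  by (simp add: sets_haar sigma_sets.Basic)

lemma closed_in_sets:
  assumes "closedin X K"
  shows "K \<in> sets \<mu>"
proof -
  have "topspace X - (topspace X - K) \<in> sets \<mu>"
    using assms open_in_sets sets.compl_sets[of "topspace X - K" \<mu>] by (simp add: space_haar closedin_def)
  then show ?thesis
    using closedin_subset[OF assms] by (simp add: double_diff)
qed

lemma carrier_in_sets: "carrier C \<in> sets \<mu>"
  by (metis open_in_sets openin_topspace topspace_eq)

text \<open>Finitely many translates of \<open>U\<close> cover the group; if \<open>U\<close> were
  null, so would be the whole group.\<close>

lemma emeasure_open_pos:
  assumes U: "openin X U" "U \<noteq> {}"
  shows "emeasure \<mu> U \<noteq> 0"
proof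
  assume 0: "emeasure \<mu> U = 0"
  obtain S where S: "finite S" "S \<subseteq> carrier C" "carrier C \<subseteq> (\<Union>s\<in>S. (\<lambda>x. s \<otimes> x) ` U)"
    using translates_cover_carrier[OF U] unfolding translates_cover_def by blast
  have "(\<Union>s\<in>S. (\<lambda>x. s \<otimes> x) ` U) \<in> null_sets \<mu>"
  proof (intro null_sets_UN' countable_finite S(1))
    fix s assume "s \<in> S"
    then have "s \<in> carrier C" using S(2) by blast
    then show "(\<lambda>x. s \<otimes> x) ` U \<in> null_sets \<mu>"
      using emeasure_translation[of s U] open_in_sets openin_translation U(1) 0
      by (intro null_setsI) auto
  qed
  then have "carrier C \<in> null_sets \<mu>"
    using S(3) carrier_in_sets null_sets_subset by blast
  then show False using emeasure_haar_carrier null_setsD1 by fastforce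
qed

text \<open>The interior of the closure of \<open>N\<close> is an open subset of the null set
  \<open>K\<close>, hence empty. Subsets \<open>N\<close> are allowed with a view to level sets of a
  function.\<close>

lemma closed_null_nowhere_dense:
  assumes K: "closedin X K" "K \<in> null_sets \<mu>" and N: "N \<subseteq> K"
  shows "nowhere_dense_in X N"
proof -
  have "X interior_of (X closure_of N) \<subseteq> K"
    using closure_of_minimal[OF N K(1)] interior_of_subset[of X "X closure_of N"] by simp
  with K(2) open_in_sets[OF openin_interior_of]
  have "X interior_of (X closure_of N) \<in> null_sets \<mu>"
    by (rule null_sets_subset)
  then have "X interior_of (X closure_of N) = {}"
    using emeasure_open_pos[OF openin_interior_of] null_setsD1 by blast
  moreover have "N \<subseteq> topspace X"
    using N closedin_subset[OF K(1)] by simp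
  ultimately show ?thesis
    by (simp add: nowhere_dense_in_def)
qed

text \<open>The \<open>n\<close> disjoint translates have total measure \<open>n\<close> times that
  of \<open>A\<close>, yet at most 1, for every \<open>n\<close>.\<close>

lemma null_if_disjoint_translates:
  assumes A: "closedin X A"
    and S: "\<And>n :: nat. \<exists>S. finite S \<and> card S = n \<and> S \<subseteq> carrier C \<and>
      disjoint_family_on (\<lambda>s. (\<lambda>x. s \<otimes> x) ` A) S"
  shows "A \<in> null_sets \<mu>"
proof -
  have As: "A \<in> sets \<mu>" using A by (rule closed_in_sets)
  have bound: "of_nat n * emeasure \<mu> A \<le> 1" for n
  proof -
    obtain S where S: "finite S" "card S = n" "S \<subseteq> carrier C"
        "disjoint_family_on (\<lambda>s. (\<lambda>x. s \<otimes> x) ` A) S"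
      using S by blast
    have sets: "(\<lambda>x. s \<otimes> x) ` A \<in> sets \<mu>" if "s \<in> S" for s
    proof -
      have "closed_map X X (\<lambda>x. s \<otimes> x)"
        using homeomorphic_translation[of s] that S(3) homeomorphic_imp_closed_map
        unfolding homeomorphic_maps_map by blast
      then show ?thesis using A closed_in_sets unfolding closed_map_def by blast
    qed
    have "of_nat n * emeasure \<mu> A = (\<Sum>s\<in>S. emeasure \<mu> ((\<lambda>x. s \<otimes> x) ` A))"
      using S As by (simp add: emeasure_translation subset_iff)
    also have "\<dots> = emeasure \<mu> (\<Union>s\<in>S. (\<lambda>x. s \<otimes> x) ` A)"
      using S sets by (intro sum_emeasure) auto
    also have "\<dots> \<le> emeasure \<mu> (space \<mu>)" by (rule emeasure_space)
    finally show ?thesis using emeasure_haar_carrier space_haar topspace_eq by simp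
  qed
  have "emeasure \<mu> A = 0"
  proof (rule ccontr)
    assume pos: "emeasure \<mu> A \<noteq> 0"
    have "emeasure \<mu> A \<le> 1" using bound[of 1] by simp
    then obtain r where r: "emeasure \<mu> A = ennreal r" "0 \<le> r"
      by (cases "emeasure \<mu> A") (auto simp: top_unique)
    then have "0 < r" using pos by (cases "r = 0") auto
    then obtain n :: nat where n: "1 < real n * r"
      using reals_Archimedean3 by blast
    have "ennreal (real n * r) \<le> 1"
      using bound[of n] r by (simp add: ennreal_mult ennreal_of_nat_eq_real_of_nat)
    then show False using n by simp
  qed
  then show ?thesis using As by (rule null_setsI)
qed

text \<open>Outside the union of the sets \<open>M n\<close> the function vanishes. It is continuous
  there as well, because the complement of each closed \<open>M n\<close> is a neighbourhood on
  which its modulus stays below 1/(n+1).\<close>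

lemma riemann_integrable_off_null_sets:
  fixes F :: "'c \<Rightarrow> complex" and M :: "nat \<Rightarrow> 'c set"
  assumes M: "\<And>n. closedin X (M n)" "\<And>n. M n \<in> null_sets \<mu>"
    and bounded: "bounded (F ` topspace X)"
    and small: "\<And>n x. x \<in> topspace X - M n \<Longrightarrow> cmod (F x) < inverse (real (Suc n))"
  shows "riemann_integrable X \<mu> F"
    and "meager_in X {x \<in> topspace X. F x \<noteq> 0}"
    and "{x \<in> topspace X. F x \<noteq> 0} \<in> null_sets (completion \<mu>)"
proof -
  have zero: "F x = 0" if x: "x \<in> topspace X" "x \<notin> (\<Union>n. M n)" for x
  proof (rule ccontr)
    assume "F x \<noteq> 0"
    then obtain n where "inverse (real (Suc n)) < cmod (F x)"
      using reals_Archimedean[of "cmod (F x)"] by auto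
    then show False using small[of x n] x by auto
  qed
  have UM: "(\<Union>n. M n) \<in> null_sets (completion \<mu>)"
    using M(2) by (intro null_sets_completionI null_sets_UN)
  have "topcontinuous_at X euclidean F x" if x: "x \<in> topspace X" "x \<notin> (\<Union>n. M n)" for x
    unfolding topcontinuous_at_def
  proof (intro conjI allI impI)
    fix V assume V: "openin euclidean V \<and> F x \<in> V"
    then obtain e where e: "0 < e" "ball 0 e \<subseteq> V"
      using zero[OF x] openE by (metis open_openin)
    obtain n where n: "inverse (real (Suc n)) < e"
      using reals_Archimedean[OF e(1)] by blast
    have "F y \<in> V" if "y \<in> topspace X - M n" for y
      using small[OF that] n e(2) by (auto simp: subset_iff)
    then show "\<exists>U. openin X U \<and> x \<in> U \<and> (\<forall>y\<in>U. F y \<in> V)"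
      using M(1)[of n] x by (intro exI[of _ "topspace X - M n"]) (auto simp: closedin_def)
  qed (use x in auto)
  then have "{x \<in> topspace X. \<not> topcontinuous_at X euclidean F x} \<subseteq> (\<Union>n. M n)" by blast
  then show "riemann_integrable X \<mu> F"
    using bounded null_sets_completion_subset[OF _ UM] by (simp add: riemann_integrable_def)
  show "{x \<in> topspace X. F x \<noteq> 0} \<in> null_sets (completion \<mu>)"
    using zero by (intro null_sets_completion_subset[OF _ UM]) blast
  \<comment> \<open>\<open>meager_in\<close> asks for an exact union, and \<open>M n\<close> may
    contain zeros of \<open>F\<close>. The level sets \<open>N n\<close> lie in \<open>M n\<close>
    and have exactly the support as their union.\<close>
  define N where "N = (\<lambda>n. {x \<in> topspace X. inverse (real (Suc n)) \<le> cmod (F x)})"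
  have "nowhere_dense_in X (N n)" for n
    using small[of _ n] by (intro closed_null_nowhere_dense[OF M(1,2)[of n]]) (force simp: N_def)
  moreover have "{x \<in> topspace X. F x \<noteq> 0} = (\<Union>n. N n)"
  proof (intro equalityI subsetI)
    fix x assume "x \<in> {x \<in> topspace X. F x \<noteq> 0}"
    then show "x \<in> (\<Union>n. N n)"
      using reals_Archimedean[of "cmod (F x)"] by (auto simp: N_def intro: less_imp_le)
  next
    fix x assume "x \<in> (\<Union>n. N n)"
    then show "x \<in> {x \<in> topspace X. F x \<noteq> 0}"
      by (auto simp: N_def)
  qed
  ultimately show "meager_in X {x \<in> topspace X. F x \<noteq> 0}"
    unfolding meager_in_def by blast
qed

end

lemma haar_measure_compactification:
  assumes "group_compactification G T C X \<iota>"
  obtains \<mu> where "haar_measure C X \<mu>"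
proof -
  have cpt: "compact_topological_group C X"
    using assms by (simp add: group_compactification_def)
  then interpret compact_group C X
    by (simp add: compact_group_def compact_group_axioms_def compact_topological_group_def topological_group_def)
  obtain \<mu> where "normalized_haar_measure C X \<mu>" using haar_measure_exists .
  then have "haar_measure C X \<mu>" by unfold_locales
  then show thesis by (rule that)
qed

section \<open>Functions vanishing at infinity on MAP groups\<close>

text \<open>The translates of \<open>K\<close> by \<open>g\<close> and by \<open>s\<close> can meet
  only if \<open>g\<close> lies in the compact set \<open>B s\<close>, which is s K K^-1. Finitely
  many such sets cannot exhaust a noncompact group.\<close>

lemma disjoint_translates_of_compact:
  fixes G (structure)
  assumes tg: "topological_group G T" and nc: "\<not> compact_space T" and K: "compactin T K"
  shows "\<exists>S. finite S \<and> card S = n \<and> S \<subseteq> carrier G \<and> disjoint_family_on (\<lambda>s. (\<lambda>x. s \<otimes> x) ` K) S"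
proof (induction n)
  case 0
  show ?case by (intro exI[of _ "{}"]) (simp add: disjoint_family_on_def)
next
  case (Suc n)
  then obtain S where S: "finite S" "card S = n" "S \<subseteq> carrier G"
      "disjoint_family_on (\<lambda>s. (\<lambda>x. s \<otimes> x) ` K) S"
    by blast
  interpret group G using tg by (simp add: topological_group_def)
  have top: "topspace T = carrier G"
    and mult: "continuous_map (prod_topology T T) T (\<lambda>(x, y). x \<otimes> y)"
    and inv: "continuous_map T T (\<lambda>x. inv x)"
    using tg by (auto simp: topological_group_def)
  have KG: "K \<subseteq> carrier G" using compactin_subset_topspace[OF K] top by simp
  define B where "B = (\<lambda>s. (\<lambda>(k, k'). (s \<otimes> k) \<otimes> inv k') ` (K \<times> K))"
  have "compactin T (B s)" if s: "s \<in> carrier G" for s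
  proof -
    have "continuous_map T (prod_topology T T) (\<lambda>x. (s, x))"
      using s top by (simp add: continuous_map_paired)
    then have "continuous_map T T (\<lambda>x. s \<otimes> x)"
      using continuous_map_compose[OF _ mult] by (fastforce simp: o_def)
    then have "continuous_map (prod_topology T T) (prod_topology T T) (\<lambda>z. (s \<otimes> fst z, inv (snd z)))"
      using continuous_map_compose[OF continuous_map_fst] continuous_map_compose[OF continuous_map_snd inv]
      by (fastforce simp: continuous_map_paired o_def)
    from continuous_map_compose[OF this mult]
    have "continuous_map (prod_topology T T) T (\<lambda>(k, k'). (s \<otimes> k) \<otimes> inv k')"
      by (simp add: o_def case_prod_unfold)
    then show ?thesis
      unfolding B_def using K by (intro image_compactin[of "prod_topology T T"]) (simp add: compactin_Times)
  qed
  then have "compactin T (\<Union>(B ` S))"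
    using S by (intro compactin_Union) auto
  \<comment> \<open>Avoiding \<open>S\<close> itself guarantees that the cardinality grows even if
    \<open>K\<close>, and with it every \<open>B s\<close>, is empty.\<close>
  then have "compactin T (S \<union> \<Union>(B ` S))"
    using S(1,3) top by (simp add: compactin_Un finite_imp_compactin)
  then have "\<not> carrier G \<subseteq> S \<union> \<Union>(B ` S)"
    using nc top compactin_subset_topspace unfolding compact_space_def by (metis subset_antisym)
  then obtain g where g: "g \<in> carrier G" "g \<notin> S" "\<And>s. s \<in> S \<Longrightarrow> g \<notin> B s" by blast
  have new: "(\<lambda>x. g \<otimes> x) ` K \<inter> (\<lambda>x. s \<otimes> x) ` K = {}" if s: "s \<in> S" for s
  proof (rule ccontr)
    assume "\<not> ?thesis"
    then obtain k k' where k: "k \<in> K" "k' \<in> K" "g \<otimes> k' = s \<otimes> k" by blast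
    have "k \<in> carrier G" "k' \<in> carrier G" "s \<in> carrier G" using k KG s S by auto
    then have "g = (s \<otimes> k) \<otimes> inv k'"
      using g(1) k(3) by (metis inv_closed inv_solve_right m_closed)
    then have "g \<in> B s" using k unfolding B_def by force
    then show False using g(3) s by blast
  qed
  have "disjoint_family_on (\<lambda>s. (\<lambda>x. s \<otimes> x) ` K) (insert g S)"
    using S(4) g(2) new by (subst disjoint_family_on_insert) auto
  then show ?case
    using S g by (intro exI[of _ "insert g S"]) simp
qed

text \<open>The functions separating different pairs of points may come with different Bohr
  compactifications. The universal property of one fixed choice factors the maps of all others
  through \<open>\<iota>\<close>, so \<open>\<iota>\<close> separates every pair.\<close>

lemma injective_compactification:
  fixes G :: "'g monoid" and T :: "'g topology"
  assumes tg: "topological_group G T" and map: "maximally_almost_periodic G T"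
  obtains C :: "'g set set monoid" and X \<iota>
  where "group_compactification G T C X \<iota>" "inj_on \<iota> (carrier G)"
proof (cases "\<exists>x\<in>carrier G. \<exists>y\<in>carrier G. x \<noteq> y")
  case True
  then obtain f where "almost_periodic G T f"
    using map unfolding maximally_almost_periodic_def by blast
  then obtain B X \<iota> where B: "bohr_compactification G T B X \<iota>"
    unfolding almost_periodic_def by blast
  note bohr = B[unfolded bohr_compactification_def]
  have "\<iota> x \<noteq> \<iota> y" if xy: "x \<in> carrier G" "y \<in> carrier G" "x \<noteq> y" for x y
  proof -
    obtain f where "almost_periodic G T f" and f: "f x \<noteq> f y"
      using map xy unfolding maximally_almost_periodic_def by blast
    then obtain B' X' \<iota>' F where "bohr_compactification G T B' X' \<iota>'"
        "\<forall>x\<in>carrier G. f x = F (\<iota>' x)"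
      unfolding almost_periodic_def by blast
    then have "group_compactification G T B' X' \<iota>'" and "f x = F (\<iota>' x)" "f y = F (\<iota>' y)"
      using xy by (simp_all add: bohr_compactification_def)
    moreover from this(1) obtain \<pi> where "\<forall>z\<in>carrier G. \<iota>' z = \<pi> (\<iota> z)"
      using bohr[THEN conjunct2, rule_format, of B' X' \<iota>'] by blast
    ultimately show ?thesis using xy f by auto
  qed
  then have "inj_on \<iota> (carrier G)" by (meson inj_onI)
  with bohr[THEN conjunct1] show thesis by (rule that)
next
  \<comment> \<open>With a single element there is no pair to separate, so the MAP assumption yields
    no Bohr compactification. The trivial group is its own compactification and is copied to the
    required type.\<close>
  case False
  interpret group G using tg by (simp add: topological_group_def)
  have carrier: "carrier G = {\<one>\<^bsub>G\<^esub>}" using False one_closed by blast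
  have top: "topspace T = carrier G" using tg by (simp add: topological_group_def)
  have "compact_space T"
    unfolding compact_space_def by (rule finite_imp_compactin) (simp_all add: top carrier)
  moreover have "Hausdorff_space T"
    by (simp add: Hausdorff_space_def top carrier)
  ultimately have "group_compactification G T G T id"
    using tg top closure_of_topspace[of T]
    by (simp add: group_compactification_def compact_topological_group_def hom_def)
  then obtain D :: "'g set set monoid" and Y h where "group_compactification G T D Y (h \<circ> id)"
    by (rule group_compactification_copy)
  then show thesis by (rule that) (simp add: carrier)
qed

text \<open>As an injective homomorphism, \<open>\<iota>\<close> carries disjoint translates of
  \<open>K n\<close> in \<open>G\<close> to equally many disjoint translates of its image in
  \<open>C\<close>, which makes that closed image null.\<close>

lemma vanishing_in_hartman_0:
  fixes G :: "'g monoid" and C :: "'g set set monoid"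
  assumes tg: "topological_group G T" and comp: "group_compactification G T C X \<iota>"
    and inj: "inj_on \<iota> (carrier G)" and nc: "\<not> compact_space T"
    and f: "f \<in> vanishing_functions T"
  shows "f \<in> hartman_functions_0 G T"
proof -
  interpret G: group G using tg by (simp add: topological_group_def)
  have topT: "topspace T = carrier G" using tg by (simp add: topological_group_def)
  have hom: "\<iota> \<in> hom G C" and cont: "continuous_map T X \<iota>"
    using comp by (auto simp: group_compactification_def)
  obtain \<mu> where "haar_measure C X \<mu>" using haar_measure_compactification[OF comp] .
  then interpret haar_measure C X \<mu> .
  define F where "F = (\<lambda>x. if x \<in> \<iota> ` carrier G then f (inv_into (carrier G) \<iota> x) else 0)"
  have F\<iota>: "F (\<iota> g) = f g" if "g \<in> carrier G" for g
    using that inj by (simp add: F_def)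
  have "\<forall>n. \<exists>K. compactin T K \<and> (\<forall>x\<in>topspace T - K. cmod (f x) < inverse (real (Suc n)))"
    using f by (simp add: vanishing_functions_def)
  then obtain K where K: "\<And>n. compactin T (K n)"
      "\<And>n x. x \<in> topspace T - K n \<Longrightarrow> cmod (f x) < inverse (real (Suc n))"
    by metis
  have closed: "closedin X (\<iota> ` K n)" for n
    using image_compactin[OF K(1) cont] compactin_imp_closedin Hausdorff by blast
  have null: "\<iota> ` K n \<in> null_sets \<mu>" for n
  proof (rule null_if_disjoint_translates[OF closed])
    fix m :: nat
    have KG: "K n \<subseteq> carrier G" using compactin_subset_topspace[OF K(1)] topT by simp
    obtain S where S: "finite S" "card S = m" "S \<subseteq> carrier G"
        "disjoint_family_on (\<lambda>s. (\<lambda>x. s \<otimes>\<^bsub>G\<^esub> x) ` K n) S"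
      using disjoint_translates_of_compact[OF tg nc K(1)] by blast
    have injS: "inj_on \<iota> S" using inj S(3) by (rule inj_on_subset)
    have im: "(\<lambda>x. \<iota> s \<otimes>\<^bsub>C\<^esub> x) ` \<iota> ` K n = \<iota> ` (\<lambda>x. s \<otimes>\<^bsub>G\<^esub> x) ` K n" if "s \<in> S" for s
      using hom_mult[OF hom] that S(3) KG by (auto simp: image_image subset_iff intro!: image_cong)
    have "disjoint_family_on (\<lambda>s. (\<lambda>x. s \<otimes>\<^bsub>C\<^esub> x) ` \<iota> ` K n) (\<iota> ` S)"
      unfolding disjoint_family_on_def
    proof (intro ballI impI)
      fix a b assume "a \<in> \<iota> ` S" "b \<in> \<iota> ` S" "a \<noteq> b"
      then obtain s t where st: "s \<in> S" "t \<in> S" "a = \<iota> s" "b = \<iota> t" "s \<noteq> t" by blast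
      have "\<iota> ` (\<lambda>x. s \<otimes>\<^bsub>G\<^esub> x) ` K n \<inter> \<iota> ` (\<lambda>x. t \<otimes>\<^bsub>G\<^esub> x) ` K n
          = \<iota> ` ((\<lambda>x. s \<otimes>\<^bsub>G\<^esub> x) ` K n \<inter> (\<lambda>x. t \<otimes>\<^bsub>G\<^esub> x) ` K n)"
        using st S(3) KG by (intro inj_on_image_Int[OF inj, symmetric]) auto
      also have "\<dots> = {}"
        using S(4) st by (simp add: disjoint_family_on_def)
      finally show "(\<lambda>x. a \<otimes>\<^bsub>C\<^esub> x) ` \<iota> ` K n \<inter> (\<lambda>x. b \<otimes>\<^bsub>C\<^esub> x) ` \<iota> ` K n = {}"
        using st im by simp
    qed
    moreover have "\<iota> ` S \<subseteq> carrier C" using hom S(3) by (auto simp: hom_def)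
    ultimately show "\<exists>S. finite S \<and> card S = m \<and> S \<subseteq> carrier C \<and>
        disjoint_family_on (\<lambda>s. (\<lambda>x. s \<otimes>\<^bsub>C\<^esub> x) ` \<iota> ` K n) S"
      using S card_image[OF injS] by (intro exI[of _ "\<iota> ` S"]) simp
  qed
  have "F ` topspace X \<subseteq> insert 0 (f ` topspace T)"
    using topT by (auto simp: F_def inv_into_into)
  moreover have "bounded (insert 0 (f ` topspace T))"
    using f unfolding vanishing_functions_def by simp
  ultimately have bounded: "bounded (F ` topspace X)"
    using bounded_subset by blast
  \<comment> \<open>A point off the image of \<open>K n\<close> either comes from a point off
    \<open>K n\<close> or lies outside the range of \<open>\<iota>\<close>, where \<open>F\<close>
    is 0.\<close>
  have small: "cmod (F x) < inverse (real (Suc n))" if x: "x \<in> topspace X - \<iota> ` K n" for n x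
  proof (cases "x \<in> \<iota> ` carrier G")
    case True
    then obtain g where "g \<in> carrier G" "x = \<iota> g" by blast
    then show ?thesis using K(2)[of g n] x topT F\<iota> by auto
  qed (simp add: F_def)
  have "\<forall>x\<in>carrier G. f x = F (\<iota> x)"
    using F\<iota> by simp
  moreover note riemann_integrable_off_null_sets[where M = "\<lambda>n. \<iota> ` K n", OF closed null bounded small]
  ultimately show ?thesis
    unfolding hartman_functions_0_def using comp haar by blast
qed

text \<open>The image of the compact group is closed and dense, so \<open>\<iota>\<close> is a
  continuous bijection from a compact onto a Hausdorff space, hence a homeomorphism, and
  \<open>f\<close> transports to a continuous function.\<close>

lemma continuous_in_hartman:
  fixes G :: "'g monoid" and C :: "'g set set monoid"
  assumes tg: "topological_group G T" and comp: "group_compactification G T C X \<iota>"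
    and inj: "inj_on \<iota> (carrier G)" and cpt: "compact_space T"
    and f: "continuous_map T euclidean f" and bounded: "bounded (f ` topspace T)"
  shows "f \<in> hartman_functions G T"
proof -
  have topT: "topspace T = carrier G" using tg by (simp add: topological_group_def)
  have cont: "continuous_map T X \<iota>" and dense: "X closure_of (\<iota> ` carrier G) = topspace X"
    using comp by (auto simp: group_compactification_def)
  obtain \<mu> where "haar_measure C X \<mu>" using haar_measure_compactification[OF comp] .
  then interpret haar_measure C X \<mu> .
  have "closedin X (\<iota> ` topspace T)"
    using image_compactin[OF _ cont] cpt compactin_imp_closedin Hausdorff
    unfolding compact_space_def by blast
  then have surj: "\<iota> ` topspace T = topspace X"
    using dense topT closure_of_closedin by metis
  have "homeomorphic_map T X \<iota>"
    using continuous_imp_homeomorphic_map[OF cont cpt Hausdorff surj] inj topT by simp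
  then obtain g where g: "homeomorphic_maps T X \<iota> g" using homeomorphic_map_maps by blast
  then have "continuous_map X T g" and g\<iota>: "\<And>x. x \<in> carrier G \<Longrightarrow> g (\<iota> x) = x"
    using topT by (auto simp: homeomorphic_maps_def)
  then have F: "continuous_map X euclidean (f \<circ> g)"
    using f continuous_map_compose by blast
  have "(f \<circ> g) ` topspace X \<subseteq> f ` topspace T"
    using continuous_map_funspace[OF \<open>continuous_map X T g\<close>] by auto
  then have "bounded ((f \<circ> g) ` topspace X)"
    using bounded by (rule bounded_subset[rotated])
  moreover have "{x \<in> topspace X. \<not> topcontinuous_at X euclidean (f \<circ> g) x} = {}"
    using F by (simp add: continuous_map_eq_topcontinuous_at)
  ultimately have "riemann_integrable X \<mu> (f \<circ> g)"
    by (simp only: riemann_integrable_def null_sets.empty_sets simp_thms)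
  moreover have "\<forall>x\<in>carrier G. f x = (f \<circ> g) (\<iota> x)"
    using g\<iota> by simp
  ultimately show ?thesis
    unfolding hartman_functions_def using comp haar by blast
qed

theorem theorem6:
  fixes G :: "'g monoid" and T :: "'g topology"
  assumes "topological_group G T"
    and "maximally_almost_periodic G T"
  shows "continuous_vanishing_functions T \<subseteq> hartman_functions G T \<and>
    (\<not> compact_space T \<longrightarrow> vanishing_functions T \<subseteq> hartman_functions_0 G T)"
proof -
  obtain C :: "'g set set monoid" and X \<iota> where
    comp: "group_compactification G T C X \<iota>" "inj_on \<iota> (carrier G)"
    using injective_compactification[OF assms] .
  have noncompact: "vanishing_functions T \<subseteq> hartman_functions_0 G T" if "\<not> compact_space T"
    using vanishing_in_hartman_0[OF assms(1) comp that] by blast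
  \<comment> \<open>For noncompact \<open>G\<close> the first inclusion follows from the second
    through this one, which leaves only compact \<open>G\<close> to be treated separately.\<close>
  moreover have "hartman_functions_0 G T \<subseteq> hartman_functions G T"
    unfolding hartman_functions_0_def hartman_functions_def by blast
  moreover have "continuous_vanishing_functions T \<subseteq> hartman_functions G T" if "compact_space T"
    using continuous_in_hartman[OF assms(1) comp that]
    by (auto simp: continuous_vanishing_functions_def vanishing_functions_def)
  ultimately show ?thesis
    unfolding continuous_vanishing_functions_def by blast
qed

end
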